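(* Let $\tau_1,\tau_2,\beta_2,\beta_3>0$ and $$G=\begin{pmatrix}-\tau_1&0&0\\ \tau_1&-\tau_2&0\\ 0&\tau_2&0\end{pmatrix},\qquad F=\begin{pmatrix}0&2\beta_2&\beta_3\\ 0&-\beta_2&\beta_3\\ 0&0&-\beta_3\end{pmatrix}.$$ For $\alpha>0$ let $\lambda_P(\alpha)$ be the Perron (dominant real) eigenvalue of $G+\alpha F$. Then there exists a maximal eigenvalue $\lambda_P(\alpha^* )$ for some $\alpha^*\in(0,+\infty)$ (i.e. $\lambda_P$ attains a global maximum on $(0,+\infty)$) if and only if $\tau_2>2\tau_1$. Furthermore, the following alternative holds: - either $\tau_2\le2\tau_1$, and $\lambda_P(\alpha)$ increases from $0$ (as $\alpha\to0$) to $\tau_1$ (as $\alpha\to+\infty$); - or $\tau_2>2\tau_1$, and $\lambda_P(\alpha)$ first increases from $0$ (as $\alpha\to 0$) to $\lambda_P(\alpha^* )$ (on $(0,\alpha^* )$) and then decreases to $\tau_1$ (on $(\alpha^*,+\infty)$, as $\alpha\to+\infty$).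
   Context: For $\alpha>0$ the matrix $G+\alpha F$ is irreducible with nonnegative off-diagonal entries, so by Perron–Frobenius it has a simple real eigenvalue $\lambda_P(\alpha)$ that is strictly larger than the real part of every other eigenvalue. *)

theory Defs
  imports "Jordan_Normal_Form.Char_Poly" Complex_Main
begin

text \<open>The dominance condition ranges over all complex eigenvalues; the condition on the order
  of the root says that the eigenvalue is algebraically simple.\<close>

definition is_perron_eigenvalue :: "real mat \<Rightarrow> real \<Rightarrow> bool" where
  "is_perron_eigenvalue A r \<longleftrightarrow>
     eigenvalue (map_mat complex_of_real A) (complex_of_real r) \<and>
     Polynomial.order (complex_of_real r) (char_poly (map_mat complex_of_real A)) = 1 \<and>
     (\<forall>\<mu>. eigenvalue (map_mat complex_of_real A) \<mu> \<and> \<mu> \<noteq> complex_of_real r \<longrightarrow> Re \<mu> < r)"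

definition perron_eigenvalue :: "real mat \<Rightarrow> real" where
  "perron_eigenvalue A = (THE r. is_perron_eigenvalue A r)"

lemma is_perron_eigenvalue_unique:
  assumes "is_perron_eigenvalue A r" "is_perron_eigenvalue A s"
  shows "r = s"
  using assms unfolding is_perron_eigenvalue_def
  by (metis Re_complex_of_real less_asym)

lemma perron_eigenvalue_eq:
  assumes "is_perron_eigenvalue A r"
  shows "perron_eigenvalue A = r"
  unfolding perron_eigenvalue_def
  using assms is_perron_eigenvalue_unique by (intro the_equality) auto

definition G_mat :: "real \<Rightarrow> real \<Rightarrow> real mat" where
  "G_mat \<tau>1 \<tau>2 = mat_of_rows_list 3
     [[- \<tau>1,   0, 0],
      [  \<tau>1, - \<tau>2, 0],
      [  0,     \<tau>2, 0]]"

definition F_mat :: "real \<Rightarrow> real \<Rightarrow> real mat" where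
  "F_mat \<beta>2 \<beta>3 = mat_of_rows_list 3
     [[0, 2 * \<beta>2,   \<beta>3],
      [0,   - \<beta>2,   \<beta>3],
      [0,       0, - \<beta>3]]"

definition lambda_P :: "real \<Rightarrow> real \<Rightarrow> real \<Rightarrow> real \<Rightarrow> real \<Rightarrow> real" where
  "lambda_P \<tau>1 \<tau>2 \<beta>2 \<beta>3 \<alpha> = perron_eigenvalue (G_mat \<tau>1 \<tau>2 + \<alpha> \<cdot>\<^sub>m F_mat \<beta>2 \<beta>3)"

end

theory Submission imports Defs begin

text \<open>The characteristic polynomial of \<open>G + \<alpha> F\<close> is a cubic \<open>p\<close> with \<open>p(0) < 0\<close>. For a positive root \<open>r\<close>
  it factors as \<open>(x - r) (x\<^sup>2 + u x + v)\<close> with \<open>u, v > 0\<close>, so \<open>r\<close> is the Perron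
  eigenvalue, and for \<open>x > 0\<close> the sign of \<open>p(x)\<close> is the sign of \<open>x - \<lambda>\<^sub>P(\<alpha>)\<close>. Now read \<open>p(x)\<close> as
  a polynomial \<open>a \<alpha>\<^sup>2 + b \<alpha> + c\<close> in \<open>\<alpha>\<close>: it is quadratic, \<open>a\<close> has the sign of \<open>x - \<tau>1\<close> and
  \<open>c > 0\<close>. The superlevel set \<open>\<lambda>\<^sub>P > x\<close> is the set of \<open>\<alpha> > 0\<close> where this quadratic is negative,
  hence a half-line for \<open>x < \<tau>1\<close> and an open bounded interval, possibly empty, for \<open>x > \<tau>1\<close>.
  At \<open>x = \<tau>1\<close> the quadratic degenerates to an affine function whose slope has the sign of
  \<open>2 \<tau>1 - \<tau>2\<close>, which decides whether \<open>\<lambda>\<^sub>P\<close> ever exceeds its limit \<open>\<tau>1\<close>.\<close>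

section \<open>Determinants and the Perron eigenvalue of a factored cubic\<close>

lemma det_3:
  assumes A: "(A :: 'a :: comm_ring_1 mat) \<in> carrier_mat 3 3"
  shows "det A =
      A $$ (0,0) * (A $$ (1,1) * A $$ (2,2) - A $$ (1,2) * A $$ (2,1))
    - A $$ (1,0) * (A $$ (0,1) * A $$ (2,2) - A $$ (0,2) * A $$ (2,1))
    + A $$ (2,0) * (A $$ (0,1) * A $$ (1,2) - A $$ (0,2) * A $$ (1,1))"
proof -
  have det_2: "det B = B $$ (0,0) * B $$ (1,1) - B $$ (0,1) * B $$ (1,0)"
    if B: "B \<in> carrier_mat 2 2" for B :: "'a mat"
  proof -
    have *: "det C = C $$ (0,0)" if "C \<in> carrier_mat 1 1" for C :: "'a mat"
      using that by (subst det_upper_triangular[of C 1]) (auto simp: upper_triangular_def diag_mat_def)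
    have c: "mat_delete B i 0 \<in> carrier_mat 1 1" for i
      using mat_delete_carrier[OF B] by simp
    have "det B = (\<Sum>i<2. B $$ (i,0) * cofactor B i 0)"
      by (rule laplace_expansion_column[OF B]) simp
    then show ?thesis
      using B unfolding cofactor_def *[OF c]
      by (simp add: lessThan_Suc numeral_2_eq_2 mat_delete_def algebra_simps)
  qed
  have c: "mat_delete A i 0 \<in> carrier_mat 2 2" for i
    using mat_delete_carrier[OF A] by simp
  have "det A = (\<Sum>i<3. A $$ (i,0) * cofactor A i 0)"
    by (rule laplace_expansion_column[OF A]) simp
  then show ?thesis
    using A unfolding cofactor_def det_2[OF c]
    by (simp add: lessThan_Suc numeral_3_eq_3 numeral_2_eq_2 mat_delete_def algebra_simps)
qed

text \<open>The quadratic factor is positive at \<open>r\<close>, so \<open>r\<close> is a simple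
  root. A root \<open>\<mu>\<close> of that factor with \<open>Re \<mu> > 0\<close> must be real, by
  the imaginary part of the equation, but a monic quadratic with positive coefficients has no
  positive root.\<close>

lemma is_perron_eigenvalue_cubicI:
  fixes A :: "real mat" and r u v :: real
  assumes A: "A \<in> carrier_mat n n"
    and cp: "char_poly A = [:- r, 1:] * [:v, u, 1:]"
    and pos: "r > 0" "u > 0" "v > 0"
  shows "is_perron_eigenvalue A r"
proof -
  let ?A = "map_mat complex_of_real A"
  let ?q = "[:complex_of_real v, complex_of_real u, 1:]"
  have cpc: "char_poly ?A = [:- complex_of_real r, 1:] * ?q"
    by (subst of_real_hom.char_poly_hom[OF A], unfold cp) (simp add: map_poly_pCons)
  have ev: "eigenvalue ?A \<mu> \<longleftrightarrow> \<mu> = complex_of_real r \<or> poly ?q \<mu> = 0" for \<mu>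
    using A by (subst eigenvalue_root_char_poly[of _ n])
      (auto simp: cpc simp del: mult_pCons_left mult_pCons_right)
  have "r * r + u * r + v > 0"
    using pos by (simp add: add_pos_pos)
  then have "complex_of_real (r * r + u * r + v) \<noteq> 0"
    by (simp only: of_real_eq_0_iff)
  also have "complex_of_real (r * r + u * r + v) = poly ?q (complex_of_real r)"
    by (simp add: algebra_simps)
  finally have nz: "poly ?q (complex_of_real r) \<noteq> 0" .
  have "Polynomial.order (complex_of_real r) (char_poly ?A) = 1"
  proof -
    have "[:- complex_of_real r, 1:] * ?q \<noteq> 0"
      by (simp del: mult_pCons_left mult_pCons_right)
    then have "Polynomial.order (complex_of_real r) (char_poly ?A) =
        Polynomial.order (complex_of_real r) [:- complex_of_real r, 1:]
        + Polynomial.order (complex_of_real r) ?q"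
      unfolding cpc by (rule order_mult)
    also have "Polynomial.order (complex_of_real r) [:- complex_of_real r, 1:] = 1"
      using order_power_n_n[of "complex_of_real r" 1] by (simp only: power_one_right)
    also have "Polynomial.order (complex_of_real r) ?q = 0"
      using nz by (rule order_0I)
    finally show ?thesis by simp
  qed
  moreover have "Re \<mu> < r" if "poly ?q \<mu> = 0" for \<mu>
  proof (rule ccontr)
    assume "\<not> Re \<mu> < r"
    then have re: "Re \<mu> > 0" using pos by simp
    have 1: "v + (Re \<mu> * u + (Re \<mu> * Re \<mu> - Im \<mu> * Im \<mu>)) = 0"
      using arg_cong[OF that, of Re] by (simp add: algebra_simps)
    have "Im \<mu> * (u + 2 * Re \<mu>) = 0"
      using arg_cong[OF that, of Im] by (simp add: algebra_simps)
    then have "Im \<mu> = 0" using re pos by simp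
    moreover have "v + (Re \<mu> * u + Re \<mu> * Re \<mu>) > 0"
      using re pos by (simp add: add_pos_pos)
    ultimately show False using 1 by simp
  qed
  ultimately show ?thesis
    unfolding is_perron_eigenvalue_def ev by blast
qed

section \<open>Signs of real quadratics\<close>

lemma eventually_quadratic_pos:
  fixes a b c :: real
  assumes "a > 0"
  shows "eventually (\<lambda>t. a * t\<^sup>2 + b * t + c > 0) at_top"
proof -
  \<comment> \<open>The second bound gives
    \<open>a * t\<^sup>2 > (\<bar>b\<bar> + \<bar>c\<bar>) * t\<close>; the bound 1 lets
    \<open>\<bar>c\<bar> * t\<close> absorb the constant term.\<close>
  have "eventually (\<lambda>t. t > max 1 ((\<bar>b\<bar> + \<bar>c\<bar>) / a)) at_top"
    by (rule eventually_gt_at_top)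
  then show ?thesis
  proof eventually_elim
    fix t :: real assume t: "t > max 1 ((\<bar>b\<bar> + \<bar>c\<bar>) / a)"
    then have "t > 1" and "a * t > \<bar>b\<bar> + \<bar>c\<bar>"
      using assms by (auto simp: field_simps)
    then have "(a * t) * t > (\<bar>b\<bar> + \<bar>c\<bar>) * t" by simp
    moreover have "\<bar>c\<bar> * t \<ge> \<bar>c\<bar>" using \<open>t > 1\<close> by (simp add: mult_le_cancel_left1)
    moreover have "\<bar>b\<bar> * t \<ge> - (b * t)"
      using \<open>t > 1\<close> abs_ge_minus_self[of "b * t"] by (simp add: abs_mult)
    moreover have "c \<ge> - \<bar>c\<bar>" by simp
    ultimately have "(a * t) * t + b * t + c > 0"
      unfolding distrib_right by linarith
    then show "a * t\<^sup>2 + b * t + c > 0"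
      by (simp add: power2_eq_square mult.assoc)
  qed
qed

text \<open>Strict convexity: the chord over \<open>s\<close> and \<open>t\<close> is nonpositive,
  and the parabola lies below it at \<open>m\<close> by exactly
  \<open>a * (t - m) * (m - s)\<close>.\<close>

lemma quadratic_neg_between:
  fixes a b c s m t :: real
  assumes "a > 0" "s < m" "m < t"
    and s: "a * s\<^sup>2 + b * s + c \<le> 0" and t: "a * t\<^sup>2 + b * t + c \<le> 0"
  shows "a * m\<^sup>2 + b * m + c < 0"
proof -
  have "(t - s) * (a * m\<^sup>2 + b * m + c) =
      (t - m) * (a * s\<^sup>2 + b * s + c) + (m - s) * (a * t\<^sup>2 + b * t + c)
      - a * (t - m) * (m - s) * (t - s)"
    by (simp add: power2_eq_square algebra_simps)
  moreover have "(t - m) * (a * s\<^sup>2 + b * s + c) \<le> 0" "(m - s) * (a * t\<^sup>2 + b * t + c) \<le> 0"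
    using assms by (auto intro: mult_nonneg_nonpos)
  moreover have "a * (t - m) * (m - s) * (t - s) > 0" using assms by simp
  ultimately have "(t - s) * (a * m\<^sup>2 + b * m + c) < 0" by linarith
  then show ?thesis using assms by (simp add: mult_less_0_iff)
qed

text \<open>Divided by its positive argument \<open>x\<close>, the quadratic becomes
  \<open>a * x + b + c / x\<close>, which is strictly decreasing; the identity in the proof is this
  comparison with denominators cleared.\<close>

lemma quadratic_neg_beyond:
  fixes a b c s m :: real
  assumes "a \<le> 0" "c > 0" "0 < s" "s < m"
    and s: "a * s\<^sup>2 + b * s + c \<le> 0"
  shows "a * m\<^sup>2 + b * m + c < 0"
proof -
  have "s * (a * m\<^sup>2 + b * m + c) = m * (a * s\<^sup>2 + b * s + c) + a * m * s * (m - s) - c * (m - s)"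
    by (simp add: power2_eq_square algebra_simps)
  moreover have "m * (a * s\<^sup>2 + b * s + c) \<le> 0" using assms by (auto intro: mult_nonneg_nonpos)
  moreover have "a * m * s * (m - s) \<le> 0"
    using assms by (simp add: mult_nonpos_nonneg)
  moreover have "c * (m - s) > 0" using assms by simp
  ultimately have "s * (a * m\<^sup>2 + b * m + c) < 0" by linarith
  then show ?thesis using assms by (simp add: mult_less_0_iff)
qed

section \<open>The characteristic polynomial as a quadratic in \<alpha>\<close>

locale two_species =
  fixes \<tau>1 \<tau>2 \<beta>2 \<beta>3 :: real
  assumes pos: "\<tau>1 > 0" "\<tau>2 > 0" "\<beta>2 > 0" "\<beta>3 > 0"
begin

abbreviation lam :: "real \<Rightarrow> real" where
  "lam \<equiv> lambda_P \<tau>1 \<tau>2 \<beta>2 \<beta>3"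

definition qa :: "real \<Rightarrow> real" where
  "qa x = \<beta>2 * \<beta>3 * (x - \<tau>1)"

definition qb :: "real \<Rightarrow> real" where
  "qb x = (\<beta>2 + \<beta>3) * x\<^sup>2 + \<tau>1 * (\<beta>3 - \<beta>2) * x - \<tau>1 * \<tau>2 * \<beta>3"

definition qc :: "real \<Rightarrow> real" where
  "qc x = x * (x + \<tau>1) * (x + \<tau>2)"

text \<open>The characteristic polynomial of G + \<alpha> F at \<open>x\<close>, collected by powers
  of \<alpha>; \<open>q_eq\<close> regroups it by powers of \<open>x\<close> to match
  \<open>char_poly_eq\<close>.\<close>

definition q :: "real \<Rightarrow> real \<Rightarrow> real" where
  "q x \<alpha> = qa x * \<alpha>\<^sup>2 + qb x * \<alpha> + qc x"

lemma qa_less_0_iff: "qa x < 0 \<longleftrightarrow> x < \<tau>1"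
  and qa_gt_0_iff: "qa x > 0 \<longleftrightarrow> x > \<tau>1"
  using pos by (auto simp: qa_def mult_less_0_iff zero_less_mult_iff)

lemma qc_pos: "x > 0 \<Longrightarrow> qc x > 0"
  using pos by (simp add: qc_def)

lemma qb_\<tau>1: "qb \<tau>1 = \<beta>3 * \<tau>1 * (2 * \<tau>1 - \<tau>2)"
  by (simp add: qb_def power2_eq_square algebra_simps)

lemma q_eq: "q x \<alpha> = x^3 + (\<tau>1 + \<tau>2 + \<alpha> * \<beta>2 + \<alpha> * \<beta>3) * x\<^sup>2
    + (\<alpha> * \<beta>2 * (\<alpha> * \<beta>3) + \<tau>1 * \<tau>2 + \<tau>1 * (\<alpha> * \<beta>3) - \<tau>1 * (\<alpha> * \<beta>2)) * x
    - \<tau>1 * (\<alpha> * \<beta>3) * (\<alpha> * \<beta>2 + \<tau>2)"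
  by (simp add: q_def qa_def qb_def qc_def power2_eq_square power3_eq_cube algebra_simps)

lemma carrier: "G_mat \<tau>1 \<tau>2 + \<alpha> \<cdot>\<^sub>m F_mat \<beta>2 \<beta>3 \<in> carrier_mat 3 3"
  by (intro carrier_matI) (simp_all add: G_mat_def F_mat_def mat_of_rows_list_def)

lemma char_poly_eq:
  "char_poly (G_mat \<tau>1 \<tau>2 + \<alpha> \<cdot>\<^sub>m F_mat \<beta>2 \<beta>3) =
    [:- (\<tau>1 * (\<alpha> * \<beta>3) * (\<alpha> * \<beta>2 + \<tau>2)),
      \<alpha> * \<beta>2 * (\<alpha> * \<beta>3) + \<tau>1 * \<tau>2 + \<tau>1 * (\<alpha> * \<beta>3) - \<tau>1 * (\<alpha> * \<beta>2),
      \<tau>1 + \<tau>2 + \<alpha> * \<beta>2 + \<alpha> * \<beta>3, 1:]"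
proof -
  show ?thesis
    unfolding char_poly_def det_3[OF char_poly_matrix_closed[OF carrier]]
    by (simp add: char_poly_matrix_def G_mat_def F_mat_def mat_of_rows_list_def algebra_simps
        numeral_2_eq_2)
qed

text \<open>Horner division by \<open>x - r\<close> yields \<open>u\<close> and \<open>v\<close>.
  The coefficient \<open>E\<close> can be negative, so \<open>v > 0\<close> is read off the constant
  term instead: \<open>D = r * v\<close> with \<open>D\<close> and \<open>r\<close>
  positive.\<close>

lemma positive_root_factor:
  assumes "\<alpha> > 0" "r > 0" and root: "q r \<alpha> = 0"
  obtains u v where "u > 0" "v > 0"
    "char_poly (G_mat \<tau>1 \<tau>2 + \<alpha> \<cdot>\<^sub>m F_mat \<beta>2 \<beta>3) = [:- r, 1:] * [:v, u, 1:]"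
    "\<And>x. q x \<alpha> = (x - r) * (x\<^sup>2 + u * x + v)"
proof -
  define A where "A = \<tau>1 + \<tau>2 + \<alpha> * \<beta>2 + \<alpha> * \<beta>3"
  define E where "E = \<alpha> * \<beta>2 * (\<alpha> * \<beta>3) + \<tau>1 * \<tau>2 + \<tau>1 * (\<alpha> * \<beta>3) - \<tau>1 * (\<alpha> * \<beta>2)"
  define D where "D = \<tau>1 * (\<alpha> * \<beta>3) * (\<alpha> * \<beta>2 + \<tau>2)"
  define u where "u = A + r"
  define v where "v = r * u + E"
  have q: "q x \<alpha> = x^3 + A * x\<^sup>2 + E * x - D" for x
    unfolding q_eq A_def E_def D_def ..
  have D: "D = r * v"
    using root unfolding q v_def u_def by (simp add: power2_eq_square power3_eq_cube algebra_simps)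
  have "D > 0" "A > 0"
    using pos assms by (auto simp: D_def A_def add_pos_pos)
  then have "u > 0" "v > 0"
    using assms D by (auto simp: u_def zero_less_mult_iff)
  moreover have "char_poly (G_mat \<tau>1 \<tau>2 + \<alpha> \<cdot>\<^sub>m F_mat \<beta>2 \<beta>3) = [:- r, 1:] * [:v, u, 1:]"
    unfolding char_poly_eq A_def[symmetric] E_def[symmetric] D_def[symmetric]
    by (simp add: D v_def u_def)
  moreover have "q x \<alpha> = (x - r) * (x\<^sup>2 + u * x + v)" for x
    unfolding q D by (simp add: v_def u_def power2_eq_square power3_eq_cube algebra_simps)
  ultimately show ?thesis by (rule that)
qed

lemma positive_root_exists:
  assumes "\<alpha> > 0"
  obtains r where "r > 0" "q r \<alpha> = 0"
proof -
  have q0: "q 0 \<alpha> < 0"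
    using pos assms by (simp add: q_eq add_pos_pos)
  \<comment> \<open>For large \<open>x\<close> all three terms of \<open>q x \<alpha>\<close> are
    positive. The second conjunct is \<open>qb x\<close>, arranged as a quadratic in
    \<open>x\<close> to fit \<open>eventually_quadratic_pos\<close>.\<close>
  have "eventually (\<lambda>x. \<beta>2 * \<beta>3 * \<alpha>\<^sup>2 * (x - \<tau>1) > 0 \<and> (\<beta>2 + \<beta>3) * x\<^sup>2
      + \<tau>1 * (\<beta>3 - \<beta>2) * x + (- \<tau>1 * \<tau>2 * \<beta>3) > 0 \<and> x > 0) at_top"
    using pos assms
    by (intro eventually_conj eventually_quadratic_pos eventually_gt_at_top
        eventually_mono[OF eventually_gt_at_top[of \<tau>1]]) auto
  then obtain x where "\<beta>2 * \<beta>3 * \<alpha>\<^sup>2 * (x - \<tau>1) > 0" "qb x > 0" and x: "x > 0"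
    unfolding eventually_at_top_linorder qb_def by force
  then have "qa x * \<alpha>\<^sup>2 > 0" "qb x * \<alpha> > 0"
    using assms by (auto simp: qa_def algebra_simps)
  then have qx: "q x \<alpha> > 0" unfolding q_def using qc_pos[OF x] by linarith
  have "continuous_on {0..x} (\<lambda>x. q x \<alpha>)"
    unfolding q_eq by (intro continuous_intros)
  then obtain r where "0 \<le> r" "r \<le> x" "q r \<alpha> = 0"
    using IVT'[of "\<lambda>x. q x \<alpha>" 0 0 x] q0 qx x by force
  with q0 show ?thesis by (intro that[of r]) (auto simp: order_less_le)
qed

lemma lam_root:
  assumes "\<alpha> > 0"
  shows "lam \<alpha> > 0" "q (lam \<alpha>) \<alpha> = 0"
proof -
  obtain r where r: "r > 0" "q r \<alpha> = 0"
    using positive_root_exists[OF assms] .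
  obtain u v where "u > 0" "v > 0"
    and cp: "char_poly (G_mat \<tau>1 \<tau>2 + \<alpha> \<cdot>\<^sub>m F_mat \<beta>2 \<beta>3) = [:- r, 1:] * [:v, u, 1:]"
    using positive_root_factor[OF assms r] .
  then have "is_perron_eigenvalue (G_mat \<tau>1 \<tau>2 + \<alpha> \<cdot>\<^sub>m F_mat \<beta>2 \<beta>3) r"
    using r by (intro is_perron_eigenvalue_cubicI[OF carrier cp])
  then have "lam \<alpha> = r"
    unfolding lambda_P_def by (rule perron_eigenvalue_eq)
  with r show "lam \<alpha> > 0" "q (lam \<alpha>) \<alpha> = 0" by simp_all
qed

lemma sgn_q:
  assumes "\<alpha> > 0" "x > 0"
  shows "sgn (q x \<alpha>) = sgn (x - lam \<alpha>)"
proof -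
  obtain u v where "u > 0" "v > 0" and q: "\<And>x. q x \<alpha> = (x - lam \<alpha>) * (x\<^sup>2 + u * x + v)"
    using positive_root_factor[OF assms(1) lam_root[OF assms(1)]] by metis
  then have "x\<^sup>2 + u * x + v > 0" using assms by (simp add: add_pos_pos)
  then show ?thesis unfolding q by (simp add: sgn_mult)
qed

lemma lam_less_iff: "\<alpha> > 0 \<Longrightarrow> x > 0 \<Longrightarrow> lam \<alpha> < x \<longleftrightarrow> q x \<alpha> > 0"
  and less_lam_iff: "\<alpha> > 0 \<Longrightarrow> x > 0 \<Longrightarrow> x < lam \<alpha> \<longleftrightarrow> q x \<alpha> < 0"
  using sgn_q[of \<alpha> x] by (auto simp: sgn_if split: if_splits)

section \<open>Continuity and limits of the Perron eigenvalue\<close>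

lemma tendsto_q: "(q x \<longlongrightarrow> q x \<alpha>) (at \<alpha> within S)"
  unfolding q_def by (intro tendsto_intros)

text \<open>For fixed \<open>x > 0\<close>, comparing \<open>lam t\<close> with \<open>x\<close>
  amounts to a strict sign condition on \<open>q x t\<close>, which persists near \<alpha> by
  continuity in \<open>t\<close>. Lower bounds \<open>x \<le> 0\<close> hold by positivity of
  \<open>lam\<close>.\<close>

lemma isCont_lam:
  assumes "\<alpha> > 0"
  shows "isCont lam \<alpha>"
proof -
  have ev_pos: "eventually (\<lambda>t. t > 0) (at \<alpha>)"
    using order_tendstoD(1)[OF tendsto_ident_at assms] .
  show ?thesis unfolding isCont_def
  proof (rule order_tendstoI)
    fix x assume x: "lam \<alpha> < x"
    then have "x > 0" using lam_root(1)[OF assms] by linarith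
    then have "eventually (\<lambda>t. q x t > 0) (at \<alpha>)"
      using x assms lam_less_iff by (intro order_tendstoD(1)[OF tendsto_q]) simp
    with ev_pos show "eventually (\<lambda>t. lam t < x) (at \<alpha>)"
      by eventually_elim (use \<open>x > 0\<close> lam_less_iff in simp)
  next
    fix x assume x: "x < lam \<alpha>"
    show "eventually (\<lambda>t. x < lam t) (at \<alpha>)"
    proof (cases "x > 0")
      case True
      then have "eventually (\<lambda>t. q x t < 0) (at \<alpha>)"
        using x assms less_lam_iff by (intro order_tendstoD(2)[OF tendsto_q]) simp
      with ev_pos show ?thesis
        by eventually_elim (use True less_lam_iff in simp)
    next
      case False
      from ev_pos show ?thesis
        by eventually_elim (use False lam_root(1) in force)
    qed
  qed
qed

lemma lam_at_right_0: "(lam \<longlongrightarrow> 0) (at_right 0)"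
proof (rule order_tendstoI)
  have ev_pos: "eventually (\<lambda>t::real. t > 0) (at_right 0)"
    by (rule eventually_at_right_less)
  {
    fix x :: real assume "x < 0"
    from ev_pos show "eventually (\<lambda>t. x < lam t) (at_right 0)"
      by eventually_elim (use \<open>x < 0\<close> lam_root(1) in force)
  }
  fix x :: real assume "0 < x"
  \<comment> \<open>At \<alpha> = 0 only \<open>qc x\<close> survives.\<close>
  then have "q x 0 > 0" by (simp add: q_def qc_pos)
  then have "eventually (\<lambda>t. q x t > 0) (at_right 0)"
    by (rule order_tendstoD(1)[OF tendsto_q])
  with ev_pos show "eventually (\<lambda>t. lam t < x) (at_right 0)"
    by eventually_elim (use \<open>0 < x\<close> lam_less_iff in simp)
qed

text \<open>For large \<alpha> the sign of \<open>q x \<alpha>\<close> is that of its leading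
  coefficient \<open>qa x\<close>, which changes sign exactly at \<open>x = \<tau>1\<close>.\<close>

lemma lam_at_top: "(lam \<longlongrightarrow> \<tau>1) at_top"
proof (rule order_tendstoI)
  have ev_pos: "eventually (\<lambda>t::real. t > 0) at_top"
    by (rule eventually_gt_at_top)
  fix x :: real
  {
    assume x: "x < \<tau>1"
    show "eventually (\<lambda>t. x < lam t) at_top"
    proof (cases "x > 0")
      case True
      have "eventually (\<lambda>t. (- qa x) * t\<^sup>2 + (- qb x) * t + (- qc x) > 0) at_top"
        using x by (intro eventually_quadratic_pos) (simp add: qa_less_0_iff)
      with ev_pos show ?thesis
        by eventually_elim (use True less_lam_iff in \<open>simp add: q_def\<close>)
    next
      case False
      from ev_pos show ?thesis
        by eventually_elim (use False lam_root(1) in force)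
    qed
  }
  assume x: "\<tau>1 < x"
  then have "eventually (\<lambda>t. qa x * t\<^sup>2 + qb x * t + qc x > 0) at_top"
    by (intro eventually_quadratic_pos) (simp add: qa_gt_0_iff)
  with ev_pos show "eventually (\<lambda>t. lam t < x) at_top"
    by eventually_elim (use x pos lam_less_iff in \<open>simp add: q_def\<close>)
qed

section \<open>Monotonicity and strict quasiconcavity\<close>

lemma lam_less_of_le_\<tau>1:
  assumes "0 < s" "s < t" "0 < x" "x \<le> \<tau>1" "x \<le> lam s"
  shows "x < lam t"
proof -
  have "q x s \<le> 0" using assms lam_less_iff[of s x] by simp
  then have "q x t < 0"
    unfolding q_def
    \<comment> \<open>The level \<open>x \<le> \<tau>1\<close> makes the leading coefficient
      nonpositive. The rotation puts the premise at \<open>s\<close> first, to be discharged by the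
      chained fact.\<close>
    by (rule quadratic_neg_beyond[rotated -1])
      (use assms qc_pos qa_gt_0_iff[of x] in auto)
  then show ?thesis using assms less_lam_iff by simp
qed

text \<open>At levels up to \<tau>1 the bound at \<open>s\<close> alone suffices; above \<tau>1 the
  quadratic is strictly convex and both endpoints enter. Weak bounds at the ends give a strict one
  inside, which rules out plateaus.\<close>

lemma lam_quasiconcave:
  assumes "0 < s" "s < m" "m < t" "0 < x" "x \<le> lam s" "x \<le> lam t"
  shows "x < lam m"
proof (cases "x \<le> \<tau>1")
  case True
  then show ?thesis using assms lam_less_of_le_\<tau>1[of s m x] by simp
next
  case False
  have "q x s \<le> 0" "q x t \<le> 0"
    using assms lam_less_iff[of s x] lam_less_iff[of t x] by simp_all
  then have "q x m < 0"
    unfolding q_def using assms False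
    by (intro quadratic_neg_between[of _ s m t]) (simp_all add: qa_gt_0_iff)
  then show ?thesis using assms less_lam_iff by simp
qed

text \<open>At level \<tau>1 the function \<open>q\<close> is affine in \<alpha> with nonnegative
  slope and positive constant term, so \<open>lam\<close> stays below \<tau>1. Then
  \<open>lam_less_of_le_\<tau>1\<close> applies at the level \<open>lam s\<close> itself.\<close>

lemma lam_strict_mono:
  assumes "\<tau>2 \<le> 2 * \<tau>1"
  shows "strict_mono_on {0<..} lam"
proof (rule strict_mono_onI)
  fix s t :: real assume st: "s \<in> {0<..}" "t \<in> {0<..}" "s < t"
  have "qb \<tau>1 \<ge> 0" using assms pos by (simp add: qb_\<tau>1)
  then have "q \<tau>1 s > 0"
    using st pos qc_pos[of \<tau>1] by (simp add: q_def qa_def add_nonneg_pos)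
  then have "lam s < \<tau>1" using st pos lam_less_iff by simp
  then show "lam s < lam t"
    using st lam_root(1)[of s] by (intro lam_less_of_le_\<tau>1[of s t "lam s"]) simp_all
qed

section \<open>The global maximum for \<tau>2 > 2 \<tau>1\<close>

lemma lam_exceeds_\<tau>1:
  assumes "\<tau>2 > 2 * \<tau>1"
  obtains \<alpha> where "\<alpha> > 0" "lam \<alpha> > \<tau>1"
proof -
  have b: "qb \<tau>1 < 0" using assms pos by (simp add: qb_\<tau>1 mult_pos_neg)
  \<comment> \<open>Twice the zero of the decreasing affine function \<open>q \<tau>1\<close>, so
    that its value there is \<open>- qc \<tau>1\<close>.\<close>
  define \<alpha> where "\<alpha> = 2 * qc \<tau>1 / - qb \<tau>1"
  have c: "qc \<tau>1 > 0" using qc_pos pos by simp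
  have "\<alpha> > 0" using b c by (simp add: \<alpha>_def field_simps)
  moreover have "q \<tau>1 \<alpha> < 0"
    using b c by (simp add: q_def qa_def \<alpha>_def)
  ultimately show ?thesis using that less_lam_iff pos by blast
qed

text \<open>Both limits, 0 and \<tau>1, lie below the value \<open>lam \<alpha>0\<close>. Outside a
  compact interval containing \<open>\<alpha>0\<close> the function is therefore smaller than
  \<open>lam \<alpha>0\<close>, and its maximum on that interval is global.\<close>

lemma lam_max:
  assumes "\<tau>2 > 2 * \<tau>1"
  obtains \<alpha>s where "\<alpha>s > 0" "\<And>\<alpha>. \<alpha> > 0 \<Longrightarrow> lam \<alpha> \<le> lam \<alpha>s"
proof -
  obtain \<alpha>0 where \<alpha>0: "\<alpha>0 > 0" "lam \<alpha>0 > \<tau>1" using lam_exceeds_\<tau>1[OF assms] .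
  have "eventually (\<lambda>t. lam t < lam \<alpha>0) (at_right 0)"
    using \<alpha>0 pos by (intro order_tendstoD(2)[OF lam_at_right_0]) simp
  then obtain a where a: "a > 0" "\<And>t. 0 < t \<Longrightarrow> t < a \<Longrightarrow> lam t < lam \<alpha>0"
    unfolding eventually_at_right_field by auto
  have "eventually (\<lambda>t. lam t < lam \<alpha>0) at_top"
    using \<alpha>0 by (intro order_tendstoD(2)[OF lam_at_top])
  then obtain b where b: "\<And>t. t \<ge> b \<Longrightarrow> lam t < lam \<alpha>0"
    unfolding eventually_at_top_linorder by auto
  \<comment> \<open>Otherwise \<open>lam \<alpha>0 < lam \<alpha>0\<close>.\<close>
  have ab: "a \<le> \<alpha>0" "\<alpha>0 \<le> b"
    using a(2)[of \<alpha>0] b[of \<alpha>0] \<alpha>0(1) by force+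
  have "continuous_on {a..b} lam"
    using a(1) isCont_lam by (intro continuous_at_imp_continuous_on) simp
  then obtain \<alpha>s where s: "\<alpha>s \<in> {a..b}" "\<And>t. t \<in> {a..b} \<Longrightarrow> lam t \<le> lam \<alpha>s"
    using continuous_attains_sup[of "{a..b}" lam] ab by auto
  have "lam \<alpha> \<le> lam \<alpha>s" if "\<alpha> > 0" for \<alpha>
  proof (cases "\<alpha> \<in> {a..b}")
    case False
    then have "lam \<alpha> < lam \<alpha>0" using a(2)[OF that] b[of \<alpha>] by force
    also have "\<dots> \<le> lam \<alpha>s" using s(2) ab by simp
    finally show ?thesis by simp
  qed (use s in simp)
  then show ?thesis using that[of \<alpha>s] s(1) a(1) by simp
qed

text \<open>Quasiconcavity between \<open>s\<close> and the maximizer at level \<open>lam s\<close>,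
  which the maximal value cannot fall below.\<close>

lemma lam_mono_before_max:
  assumes "\<And>\<alpha>. \<alpha> > 0 \<Longrightarrow> lam \<alpha> \<le> lam \<alpha>s"
  shows "strict_mono_on {0<..<\<alpha>s} lam"
proof (rule strict_mono_onI)
  fix s t assume "s \<in> {0<..<\<alpha>s}" "t \<in> {0<..<\<alpha>s}" "s < t"
  then show "lam s < lam t"
    using assms lam_root(1) by (intro lam_quasiconcave[of s t \<alpha>s "lam s"]) simp_all
qed

lemma lam_antimono_after_max:
  assumes "\<alpha>s > 0" "\<And>\<alpha>. \<alpha> > 0 \<Longrightarrow> lam \<alpha> \<le> lam \<alpha>s"
  shows "strict_antimono_on {\<alpha>s<..} lam"
proof (rule monotone_onI)
  fix s t assume "s \<in> {\<alpha>s<..}" "t \<in> {\<alpha>s<..}" "s < t"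
  then show "lam s > lam t"
    using assms lam_root(1) by (intro lam_quasiconcave[of \<alpha>s s t "lam t"]) simp_all
qed

lemma attains_max_iff: "(\<exists>\<alpha>s>0. \<forall>\<alpha>>0. lam \<alpha> \<le> lam \<alpha>s) \<longleftrightarrow> \<tau>2 > 2 * \<tau>1"
proof
  assume "\<exists>\<alpha>s>0. \<forall>\<alpha>>0. lam \<alpha> \<le> lam \<alpha>s"
  then obtain \<alpha>s where s: "\<alpha>s > 0" "\<forall>\<alpha>>0. lam \<alpha> \<le> lam \<alpha>s" by blast
  \<comment> \<open>Strict increase on the whole half-line would give a larger value one unit to the
    right of the maximizer.\<close>
  have "\<not> strict_mono_on {0<..} lam"
  proof
    assume "strict_mono_on {0<..} lam"
    then have "lam \<alpha>s < lam (\<alpha>s + 1)"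
      using s(1) by (intro strict_mono_onD[of "{0<..}" lam]) auto
    moreover have "lam (\<alpha>s + 1) \<le> lam \<alpha>s" using s by simp
    ultimately show False by simp
  qed
  then show "\<tau>2 > 2 * \<tau>1" using lam_strict_mono by force
next
  assume "\<tau>2 > 2 * \<tau>1"
  then obtain \<alpha>s where "\<alpha>s > 0" "\<And>\<alpha>. \<alpha> > 0 \<Longrightarrow> lam \<alpha> \<le> lam \<alpha>s"
    using lam_max by metis
  then show "\<exists>\<alpha>s>0. \<forall>\<alpha>>0. lam \<alpha> \<le> lam \<alpha>s" by blast
qed

end

theorem proposition2p1:
  fixes \<tau>1 \<tau>2 \<beta>2 \<beta>3 :: real
  assumes "\<tau>1 > 0" and "\<tau>2 > 0" and "\<beta>2 > 0" and "\<beta>3 > 0"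
  shows
    "((\<exists>\<alpha>s>0. \<forall>\<alpha>>0. lambda_P \<tau>1 \<tau>2 \<beta>2 \<beta>3 \<alpha> \<le> lambda_P \<tau>1 \<tau>2 \<beta>2 \<beta>3 \<alpha>s) \<longleftrightarrow> \<tau>2 > 2 * \<tau>1)
     \<and> ((\<tau>2 \<le> 2 * \<tau>1
          \<and> strict_mono_on {0<..} (lambda_P \<tau>1 \<tau>2 \<beta>2 \<beta>3)
          \<and> (lambda_P \<tau>1 \<tau>2 \<beta>2 \<beta>3 \<longlongrightarrow> 0) (at_right 0)
          \<and> (lambda_P \<tau>1 \<tau>2 \<beta>2 \<beta>3 \<longlongrightarrow> \<tau>1) at_top)
        \<or> (\<tau>2 > 2 * \<tau>1
          \<and> (\<exists>\<alpha>s>0.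
                (\<forall>\<alpha>>0. lambda_P \<tau>1 \<tau>2 \<beta>2 \<beta>3 \<alpha> \<le> lambda_P \<tau>1 \<tau>2 \<beta>2 \<beta>3 \<alpha>s)
              \<and> strict_mono_on {0<..<\<alpha>s} (lambda_P \<tau>1 \<tau>2 \<beta>2 \<beta>3)
              \<and> (lambda_P \<tau>1 \<tau>2 \<beta>2 \<beta>3 \<longlongrightarrow> 0) (at_right 0)
              \<and> (lambda_P \<tau>1 \<tau>2 \<beta>2 \<beta>3 \<longlongrightarrow> lambda_P \<tau>1 \<tau>2 \<beta>2 \<beta>3 \<alpha>s) (at \<alpha>s)
              \<and> strict_antimono_on {\<alpha>s<..} (lambda_P \<tau>1 \<tau>2 \<beta>2 \<beta>3)
              \<and> (lambda_P \<tau>1 \<tau>2 \<beta>2 \<beta>3 \<longlongrightarrow> \<tau>1) at_top)))"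
proof -
  interpret two_species \<tau>1 \<tau>2 \<beta>2 \<beta>3
    using assms by unfold_locales
  show ?thesis
  proof (cases "\<tau>2 > 2 * \<tau>1")
    case True
    obtain \<alpha>s where s: "\<alpha>s > 0" "\<And>\<alpha>. \<alpha> > 0 \<Longrightarrow> lam \<alpha> \<le> lam \<alpha>s"
      using lam_max[OF True] by metis
    have "(lam \<longlongrightarrow> lam \<alpha>s) (at \<alpha>s)"
      using isCont_lam[OF s(1)] by (simp add: isCont_def)
    then have "\<exists>\<alpha>s>0. (\<forall>\<alpha>>0. lam \<alpha> \<le> lam \<alpha>s)
        \<and> strict_mono_on {0<..<\<alpha>s} lam \<and> (lam \<longlongrightarrow> 0) (at_right 0)
        \<and> (lam \<longlongrightarrow> lam \<alpha>s) (at \<alpha>s) \<and> strict_antimono_on {\<alpha>s<..} lam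
        \<and> (lam \<longlongrightarrow> \<tau>1) at_top"
      using s lam_at_right_0 lam_at_top lam_mono_before_max[OF s(2)] lam_antimono_after_max[OF s]
      by (intro exI[of _ \<alpha>s]) simp
    with True attains_max_iff show ?thesis by (intro conjI disjI2)
  next
    case False
    then have "\<tau>2 \<le> 2 * \<tau>1" by simp
    with attains_max_iff lam_strict_mono lam_at_right_0 lam_at_top
    show ?thesis by (intro conjI disjI1)
  qed
qed

end
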